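(* Let $n\ge 2$, let $\beta\in(0,1)$, and let $Y$ be a random vector in $\mathbb{R}^n$ whose support is not contained on a single line. (a) If $Y$ has a non-skewed distribution and there exists some $\xi\in S^{n-1}$ for which $q^Y(\beta\xi)\neq q^Y(-\beta\xi)$, then $\gamma_1^Y(\beta)=\gamma_2^Y(\beta)=0$. (b) If $Y$ has a spherically symmetric distribution and $q^Y(\beta\xi)\neq m^Y$ for all $\xi\in S^{n-1}$, then $\alpha^Y(\beta)=0$. (c) Let $A$ be an orthogonal $n\times n$ matrix, $c>0$, $v\in\mathbb{R}^n$, and $\beta'\in(\beta,1)$. Then $$\delta_1^{cAY+v}(\beta)=c\,\delta_1^{Y}(\beta),\qquad \delta_2^{cAY+v}(\beta)=c\,\delta_2^{Y}(\beta).$$ If there exists some $\xi\in S^{n-1}$ for which $q^Y(\beta\xi)\neq q^Y(-\beta\xi)$, then $$\gamma_1^{cAY+v}(\beta)=\gamma_1^{Y}(\beta),\quad \gamma_2^{cAY+v}(\beta)=\gamma_2^{Y}(\beta),\quad \kappa_1^{cAY+v}(\beta,\beta')=\kappa_1^{Y}(\beta,\beta'),\quad \kappa_2^{cAY+v}(\beta,\beta')=\kappa_2^{Y}(\beta,\beta').$$ If $q^Y(\beta\xi)\neq m^Y$ for all $\xi\in S^{n-1}$, then $\alpha^{cAY+v}(\beta)=\alpha^{Y}(\beta)$.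
   Context: Let $\lVert\cdot\rVert$ and $\langle\cdot,\cdot\rangle$ be the Euclidean norm and inner product on $\mathbb{R}^n$, $B_1^n(0)$ the open unit ball centered at $0$, and $S^{n-1}$ the unit sphere in $\mathbb{R}^n$. Geometric quantiles: for a random vector $X$ in $\mathbb{R}^n$ and $u\in B_1^n(0)$, the $u$-quantile of $X$ is the value of $p\in\mathbb{R}^n$ that minimizes $E[\lVert X-p\rVert+\langle u,X-p\rangle]$. It is known that if $n\ge2$ and the support of $X$ is not contained on a single line, then a unique $u$-quantile of $X$ exists for every $u\in B_1^n(0)$, and the map $q^X:B_1^n(0)\to\mathbb{R}^n$ sending $u$ to the $u$-quantile of $X$ is continuous. Put $m^X:=q^X(0)$. For such $X$ and $0<\beta<\beta'<1$, with $d\xi$ the standard surface measure on $S^{n-1}$ and $SA(n-1)$ the surface area of $S^{n-1}$, define $$\delta_1^X(\beta):=\sup_{\xi\in S^{n-1}}\lVert q^X(\beta\xi)-q^X(-\beta\xi)\rVert,\qquad \delta_2^X(\beta):=\frac{1}{SA(n-1)}\int_{S^{n-1}}\lVert q^X(\beta\xi)-q^X(-\beta\xi)\rVert\,d\xi,$$ $$\gamma_1^X(\beta):=\frac{\sup_{\xi\in S^{n-1}}\lVert q^X(\beta\xi)+q^X(-\beta\xi)-2m^X\rVert}{\delta_1^X(\beta)},\qquad \gamma_2^X(\beta):=\frac{\int_{S^{n-1}}(q^X(\beta\xi)-m^X)\,d\xi/SA(n-1)}{\delta_2^X(\beta)},$$ $$\kappa_1^X(\beta,\beta'):=\frac{\delta_1^X(\beta')}{\delta_1^X(\beta)},\qquad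 \kappa_2^X(\beta,\beta'):=\frac{\delta_2^X(\beta')}{\delta_2^X(\beta)},\qquad \alpha^X(\beta):=\log\left(\frac{\sup_{\xi\in S^{n-1}}\lVert q^X(\beta\xi)-m^X\rVert}{\inf_{\xi\in S^{n-1}}\lVert q^X(\beta\xi)-m^X\rVert}\right).$$ Here $\gamma_1^X(\beta)$ is a scalar and $\gamma_2^X(\beta)$ is a vector in $\mathbb{R}^n$. The quantities $\gamma_1^X(\beta),\gamma_2^X(\beta),\kappa_1^X(\beta,\beta'),\kappa_2^X(\beta,\beta')$ are well defined if and only if $q^X(\beta\xi)\ne q^X(-\beta\xi)$ for some $\xi\in S^{n-1}$, and $\alpha^X(\beta)$ is defined in $\mathbb{R}$ if and only if $q^X(\beta\xi)\neq m^X$ for all $\xi\in S^{n-1}$. $X$ has a non-skewed distribution if $X-m^X$ and $-(X-m^X)$ have identical distributions. $X$ has a spherically symmetric distribution if $X-m^X$ and $A(X-m^X)$ have identical distributions for all orthogonal $n\times n$ matrices $A$.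
   Formalization: In (c) the vector identity is corrected to γ₂^{cAY+v}(β) = A γ₂^Y(β), since the printed γ₂^{cAY+v}(β) = γ₂^Y(β) fails e.g. for A = −I when γ₂^Y(β) ≠ 0; quantiles minimize expected loss differences, so no moment assumption is needed. *)

theory Defs
  imports "HOL-Probability.Probability"
begin

definition quantile_loss :: "real^'n \<Rightarrow> real^'n \<Rightarrow> real^'n \<Rightarrow> real"
  where "quantile_loss u p x = norm (x - p) + u \<bullet> (x - p)"

text \<open>The expected loss may be infinite for every \<open>p\<close>, but differences of losses are bounded.
  Hence minimality of \<open>p\<close> is expressed by the sign of expected differences, which is the usual
  convention making quantiles meaningful without a moment assumption. For integrable \<open>X\<close> it says
  literally that \<open>p\<close> minimizes the expected loss: see \<open>is_geom_quantile_iff\<close> below.\<close>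

definition is_geom_quantile :: "'a measure \<Rightarrow> ('a \<Rightarrow> real^'n) \<Rightarrow> real^'n \<Rightarrow> real^'n \<Rightarrow> bool"
  where "is_geom_quantile M X u p \<longleftrightarrow>
    (\<forall>p'. (LINT \<omega>|M. quantile_loss u p (X \<omega>) - quantile_loss u p' (X \<omega>)) \<le> 0)"

lemma quantile_loss_diff_bounded:
  "\<bar>quantile_loss u p x - quantile_loss u p' x\<bar> \<le> (1 + norm u) * norm (p - p')"
proof -
  have "\<bar>norm (x - p) - norm (x - p')\<bar> \<le> norm (p - p')"
    using norm_triangle_ineq3[of "x - p" "x - p'"] by (simp add: norm_minus_commute)
  moreover have "\<bar>u \<bullet> (p' - p)\<bar> \<le> norm u * norm (p - p')"
    using Cauchy_Schwarz_ineq2[of u "p' - p"] by (simp add: norm_minus_commute)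
  moreover have "quantile_loss u p x - quantile_loss u p' x =
      (norm (x - p) - norm (x - p')) + u \<bullet> (p' - p)"
    by (simp add: quantile_loss_def inner_diff_right)
  ultimately show ?thesis
    by (simp add: algebra_simps)
qed

lemma integrable_quantile_loss_diff:
  assumes "prob_space M" and [measurable]: "X \<in> borel_measurable M"
  shows "integrable M (\<lambda>\<omega>. quantile_loss u p (X \<omega>) - quantile_loss u p' (X \<omega>))"
proof -
  interpret prob_space M by fact
  show ?thesis
  proof (rule integrable_const_bound[where B = "(1 + norm u) * norm (p - p')"])
    show "AE \<omega> in M. norm (quantile_loss u p (X \<omega>) - quantile_loss u p' (X \<omega>))
        \<le> (1 + norm u) * norm (p - p')"
      using quantile_loss_diff_bounded[of u p _ p'] by simp
  qed (simp add: quantile_loss_def)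
qed

lemma is_geom_quantile_iff:
  assumes "prob_space M" and "integrable M X"
  shows "is_geom_quantile M X u p \<longleftrightarrow>
    (\<forall>p'. (LINT \<omega>|M. norm (X \<omega> - p) + u \<bullet> (X \<omega> - p))
        \<le> (LINT \<omega>|M. norm (X \<omega> - p') + u \<bullet> (X \<omega> - p')))"
proof -
  interpret prob_space M by fact
  have "integrable M (\<lambda>\<omega>. quantile_loss u a (X \<omega>))" for a
    unfolding quantile_loss_def using assms(2) by auto
  then show ?thesis
    unfolding is_geom_quantile_def by (simp add: quantile_loss_def)
qed

definition geom_quantile :: "'a measure \<Rightarrow> ('a \<Rightarrow> real^'n) \<Rightarrow> real^'n \<Rightarrow> real^'n"
  where "geom_quantile M X u = (THE p. is_geom_quantile M X u p)"

definition geom_median :: "'a measure \<Rightarrow> ('a \<Rightarrow> real^'n) \<Rightarrow> real^'n"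
  where "geom_median M X = geom_quantile M X 0"

definition rv_support :: "'a measure \<Rightarrow> ('a \<Rightarrow> real^'n) \<Rightarrow> (real^'n) set"
  where "rv_support M X =
    {x. \<forall>U. open U \<longrightarrow> x \<in> U \<longrightarrow> measure (distr M borel X) U > 0}"

definition non_skewed :: "'a measure \<Rightarrow> ('a \<Rightarrow> real^'n) \<Rightarrow> bool"
  where "non_skewed M X \<longleftrightarrow>
    distr M borel (\<lambda>\<omega>. X \<omega> - geom_median M X) = distr M borel (\<lambda>\<omega>. - (X \<omega> - geom_median M X))"

definition spherically_symmetric :: "'a measure \<Rightarrow> ('a \<Rightarrow> real^'n) \<Rightarrow> bool"
  where "spherically_symmetric M X \<longleftrightarrow>
    (\<forall>A :: real^'n^'n. orthogonal_matrix A \<longrightarrow>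
      distr M borel (\<lambda>\<omega>. X \<omega> - geom_median M X) =
      distr M borel (\<lambda>\<omega>. A *v (X \<omega> - geom_median M X)))"

text \<open>Surface measure on the unit sphere, from polar coordinates: the area of a set \<open>B\<close> is
  the dimension times the volume of the solid cone over \<open>B\<close>
  (see \<open>emeasure_sphere_surface\<close>). On vectors, \<open>sgn x\<close> is \<open>x\<close> divided by its norm.\<close>

definition sphere_surface :: "(real^'n) measure"
  where "sphere_surface = scale_measure (of_nat CARD('n))
    (distr (restrict_space lborel (ball 0 1 - {0})) (restrict_space borel (sphere 0 1)) sgn)"

lemma sphere_surface_sgn_measurable:
  "(sgn :: real^'n \<Rightarrow> real^'n) \<in>
    restrict_space lborel (ball 0 1 - {0}) \<rightarrow>\<^sub>M restrict_space borel (sphere 0 1)"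
proof (rule measurable_restrict_space2)
  show "(sgn :: real^'n \<Rightarrow> real^'n) \<in> space (restrict_space lborel (ball 0 1 - {0})) \<rightarrow> sphere 0 1"
    by (auto simp: space_restrict_space norm_sgn)
  show "(sgn :: real^'n \<Rightarrow> real^'n) \<in> borel_measurable (restrict_space lborel (ball 0 1 - {0}))"
    unfolding sgn_div_norm by (intro measurable_restrict_space1) measurable
qed

lemma space_sphere_surface: "space (sphere_surface :: (real^'n) measure) = sphere 0 1"
  by (simp add: sphere_surface_def space_scale_measure space_restrict_space)

lemma sets_sphere_surface:
  "sets (sphere_surface :: (real^'n) measure) = sets (restrict_space borel (sphere 0 1))"
  by (simp add: sphere_surface_def)

lemma emeasure_sphere_surface:
  fixes B :: "(real^'n) set"
  assumes "B \<in> sets borel" and "B \<subseteq> sphere 0 1"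
  shows "emeasure sphere_surface B =
    of_nat CARD('n) * emeasure lborel {x. 0 < norm x \<and> norm x < 1 \<and> sgn x \<in> B}"
proof -
  have B: "B \<in> sets (restrict_space borel (sphere 0 1))"
    using assms by (auto simp: sets_restrict_space)
  have eq: "sgn -` B \<inter> (ball 0 1 - {0}) = {x :: real^'n. 0 < norm x \<and> norm x < 1 \<and> sgn x \<in> B}"
    by auto
  have "emeasure sphere_surface B = of_nat CARD('n) *
      emeasure (restrict_space lborel (ball 0 1 - {0})) (sgn -` B \<inter> (ball 0 1 - {0}))"
    unfolding sphere_surface_def
    by (simp add: emeasure_distr[OF sphere_surface_sgn_measurable B] space_restrict_space)
  also have "\<dots> = of_nat CARD('n) * emeasure lborel (sgn -` B \<inter> (ball 0 1 - {0}))"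
    by (subst emeasure_restrict_space) auto
  finally show ?thesis
    unfolding eq .
qed

definition sphere_area :: "'n::finite itself \<Rightarrow> real"
  where "sphere_area _ = measure (sphere_surface :: (real^'n) measure) (sphere 0 1)"

definition delta1 :: "'a measure \<Rightarrow> ('a \<Rightarrow> real^'n) \<Rightarrow> real \<Rightarrow> real"
  where "delta1 M X \<beta> = (SUP \<xi>\<in>sphere 0 1.
    norm (geom_quantile M X (\<beta> *\<^sub>R \<xi>) - geom_quantile M X (- (\<beta> *\<^sub>R \<xi>))))"

definition delta2 :: "'a measure \<Rightarrow> ('a \<Rightarrow> real^'n) \<Rightarrow> real \<Rightarrow> real"
  where "delta2 M X \<beta> = 1 / sphere_area TYPE('n) * (LINT \<xi>|sphere_surface.
    norm (geom_quantile M X (\<beta> *\<^sub>R \<xi>) - geom_quantile M X (- (\<beta> *\<^sub>R \<xi>))))"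

definition gamma1 :: "'a measure \<Rightarrow> ('a \<Rightarrow> real^'n) \<Rightarrow> real \<Rightarrow> real"
  where "gamma1 M X \<beta> = (SUP \<xi>\<in>sphere 0 1.
    norm (geom_quantile M X (\<beta> *\<^sub>R \<xi>) + geom_quantile M X (- (\<beta> *\<^sub>R \<xi>))
      - 2 *\<^sub>R geom_median M X)) / delta1 M X \<beta>"

text \<open>A vector: under \<open>X \<mapsto> c *\<^sub>R (A *v X) + v\<close> with \<open>A\<close> orthogonal it is equivariant (it gets
  multiplied by \<open>A\<close>) and not invariant like the scalar quantities.\<close>

definition gamma2 :: "'a measure \<Rightarrow> ('a \<Rightarrow> real^'n) \<Rightarrow> real \<Rightarrow> real^'n"
  where "gamma2 M X \<beta> =
    ((LINT \<xi>|sphere_surface. geom_quantile M X (\<beta> *\<^sub>R \<xi>) - geom_median M X)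
      /\<^sub>R sphere_area TYPE('n)) /\<^sub>R delta2 M X \<beta>"

definition kappa1 :: "'a measure \<Rightarrow> ('a \<Rightarrow> real^'n) \<Rightarrow> real \<Rightarrow> real \<Rightarrow> real"
  where "kappa1 M X \<beta> \<beta>' = delta1 M X \<beta>' / delta1 M X \<beta>"

definition kappa2 :: "'a measure \<Rightarrow> ('a \<Rightarrow> real^'n) \<Rightarrow> real \<Rightarrow> real \<Rightarrow> real"
  where "kappa2 M X \<beta> \<beta>' = delta2 M X \<beta>' / delta2 M X \<beta>"

definition alpha :: "'a measure \<Rightarrow> ('a \<Rightarrow> real^'n) \<Rightarrow> real \<Rightarrow> real"
  where "alpha M X \<beta> = ln (
    (SUP \<xi>\<in>sphere 0 1. norm (geom_quantile M X (\<beta> *\<^sub>R \<xi>) - geom_median M X)) /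
    (INF \<xi>\<in>sphere 0 1. norm (geom_quantile M X (\<beta> *\<^sub>R \<xi>) - geom_median M X)))"

end

theory Submission
  imports Defs
begin

text \<open>For an orthogonal map \<open>f\<close> and \<open>c > 0\<close>, replacing \<open>u\<close>, \<open>p\<close>, \<open>x\<close> by \<open>f u\<close>, \<open>c *\<^sub>R f p + v\<close>,
  \<open>c *\<^sub>R f x + v\<close> multiplies the quantile loss by \<open>c\<close>. Minimizers therefore correspond, and wherever
  the quantile \<open>q\<close> of \<open>X\<close> is unique, the quantile of \<open>c *\<^sub>R f X + v\<close> at \<open>f u\<close> is
  \<open>c *\<^sub>R f (q u) + v\<close> (\<open>geom_quantile_similarity\<close>). If \<open>X - m\<close> and \<open>f (X - m)\<close> have the same
  distribution, this turns into a symmetry of the quantile map itself: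
  \<open>q (f u) - m = f (q u - m)\<close> (\<open>geom_quantile_symmetry\<close>).

  With \<open>f\<close> the reflection in the origin, the centred quantile map of a non-skewed distribution is
  odd, which kills both skewness measures. With \<open>f\<close> ranging over all orthogonal maps, the distance
  to the median is constant on the sphere of radius \<open>\<beta>\<close>, which kills the asphericity. The invariance
  of the remaining measures follows by substituting \<open>f \<xi>\<close> for \<open>\<xi>\<close> in each supremum, infimum or
  integral over the sphere and pulling out \<open>c\<close>.

  Three facts underlie this. The quantile exists because the expected loss, normalized at \<open>0\<close>, is
  continuous and coercive (\<open>bounded_improvers\<close>), and it is unique because equality in the triangle
  inequality would concentrate the distribution on a line (\<open>geom_quantile_unique\<close>). The quantiles of
  a fixed level \<open>\<beta> < 1\<close> form a bounded set, so that the suprema are genuine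
  (\<open>geom_quantile_bounded\<close>). And the surface measure is invariant under orthogonal maps
  (\<open>distr_sphere_surface_orthogonal_transformation\<close>), because Lebesgue measure is.\<close>

section \<open>Rotation invariance of Lebesgue measure and of the surface measure\<close>

lemma lborel_reflect: "distr lborel borel (\<lambda>x. t - x) = (lborel :: 'a::euclidean_space measure)"
  using lborel_affine[of "-1" t, symmetric] by (simp add: density_1)

text \<open>Uniqueness of Haar measure in the form needed here. Both \<open>N A * vol B\<close> and \<open>vol A * N B\<close>,
  with \<open>B\<close> the unit ball, are the double integral of \<open>1\<^sub>A(x) 1\<^sub>B(y + x)\<close> against \<open>N\<close> in \<open>x\<close>
  and Lebesgue measure in \<open>y\<close>: integrate over \<open>y\<close> first, or shift \<open>x\<close> by \<open>- y\<close> before doing so.\<close>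

lemma translation_invariant_eq_lborel:
  fixes N :: "'a::euclidean_space measure"
  assumes "sigma_finite_measure N"
    and sets_N[measurable_cong]: "sets N = sets borel"
    and translate: "\<And>a. distr N borel ((+) a) = N"
    and ball: "emeasure N (ball 0 1) = emeasure lborel (ball (0::'a) 1)"
  shows "N = lborel"
proof (rule measure_eqI)
  show "sets N = sets lborel"
    using sets_N by simp
next
  fix A assume "A \<in> sets N"
  then have [measurable]: "A \<in> sets borel"
    using sets_N by simp
  define B where "B = ball (0::'a) 1"
  have [measurable]: "B \<in> sets borel"
    by (simp add: B_def)
  interpret N: sigma_finite_measure N
    by fact
  interpret P: pair_sigma_finite lborel N ..
  have "emeasure N A * emeasure lborel B = (\<integral>\<^sup>+x. indicator A x * emeasure lborel B \<partial>N)"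
    by (simp add: nn_integral_multc)
  also have "\<dots> = (\<integral>\<^sup>+x. indicator A x * (\<integral>\<^sup>+y. indicator B y \<partial>distr lborel borel ((+) x)) \<partial>N)"
    by (simp add: lborel_distr_plus)
  also have "\<dots> = (\<integral>\<^sup>+x. \<integral>\<^sup>+y. indicator A x * indicator B (x + y) \<partial>lborel \<partial>N)"
    by (subst nn_integral_distr) (simp_all add: nn_integral_cmult)
  also have "\<dots> = (\<integral>\<^sup>+y. \<integral>\<^sup>+x. indicator A x * indicator B (x + y) \<partial>N \<partial>lborel)"
    by (intro P.Fubini') measurable
  also have "\<dots> = (\<integral>\<^sup>+y. \<integral>\<^sup>+x. indicator A x * indicator B (x + y) \<partial>distr N borel ((+) (- y)) \<partial>lborel)"
    by (simp add: translate)
  also have "\<dots> = (\<integral>\<^sup>+y. \<integral>\<^sup>+x. indicator A (x - y) * indicator B x \<partial>N \<partial>lborel)"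
    by (simp add: nn_integral_distr)
  also have "\<dots> = (\<integral>\<^sup>+x. \<integral>\<^sup>+y. indicator A (x - y) * indicator B x \<partial>lborel \<partial>N)"
    by (intro P.Fubini'[symmetric]) measurable
  also have "\<dots> = (\<integral>\<^sup>+x. (\<integral>\<^sup>+y. indicator A y \<partial>distr lborel borel (\<lambda>y. x - y)) * indicator B x \<partial>N)"
    by (subst nn_integral_distr) (simp_all add: nn_integral_multc)
  also have "\<dots> = emeasure lborel A * emeasure N B"
    by (simp add: lborel_reflect nn_integral_cmult)
  finally have "emeasure lborel B * emeasure N A = emeasure lborel B * emeasure lborel A"
    using ball by (simp add: B_def mult.commute)
  moreover have "emeasure lborel B \<noteq> 0"
    using content_ball_pos[of 1 "0::'a"] by (auto simp: B_def measure_def)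
  moreover have "emeasure lborel B \<noteq> \<top>"
    using emeasure_lborel_ball_finite[of "0::'a" 1] by (simp add: B_def less_top)
  ultimately show "emeasure N A = emeasure lborel A"
    by (simp add: ennreal_mult_cancel_left)
qed

lemma orthogonal_transformation_vimage_ball:
  "orthogonal_transformation f \<Longrightarrow> f -` ball 0 r = ball 0 r"
  by (auto simp: orthogonal_transformation)

lemma orthogonal_transformation_borel_measurable:
  fixes f :: "'a::euclidean_space \<Rightarrow> 'a"
  assumes "orthogonal_transformation f"
  shows "f \<in> borel_measurable borel"
  by (intro borel_measurable_continuous_onI linear_continuous_on)
     (simp add: assms linear_conv_bounded_linear[symmetric] orthogonal_transformation_linear)

text \<open>The image of Lebesgue measure under \<open>f\<close> is again translation invariant, as \<open>f\<close> is additive and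
  onto, and \<open>f\<close> preserves the unit ball.\<close>

lemma distr_lborel_orthogonal_transformation:
  fixes f :: "'a::euclidean_space \<Rightarrow> 'a"
  assumes f: "orthogonal_transformation f"
  shows "distr lborel borel f = lborel"
proof (rule translation_invariant_eq_lborel)
  note [measurable] = orthogonal_transformation_borel_measurable[OF f]
  have ball: "emeasure (distr lborel borel f) (ball 0 r) = emeasure lborel (ball (0::'a) r)" for r
    by (simp add: emeasure_distr orthogonal_transformation_vimage_ball[OF f])
  then show "emeasure (distr lborel borel f) (ball 0 1) = emeasure lborel (ball (0::'a) 1)" .
  show "sigma_finite_measure (distr lborel borel f)"
  proof (standard, intro exI conjI)
    show "countable (range (\<lambda>n::nat. ball (0::'a) (real n)))"
      by simp
    show "\<Union> (range (\<lambda>n::nat. ball (0::'a) (real n))) = space (distr lborel borel f)"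
      by (auto simp: reals_Archimedean2)
    show "\<forall>a\<in>range (\<lambda>n::nat. ball (0::'a) (real n)). emeasure (distr lborel borel f) a \<noteq> \<infinity>"
      using emeasure_lborel_ball_finite[of "0::'a"] by (auto simp: ball less_top)
  qed auto
  show "distr (distr lborel borel f) borel ((+) a) = distr lborel borel f" for a
  proof -
    obtain b where b: "f b = a"
      using orthogonal_transformation_surj[OF f] by (metis surjD)
    have "distr (distr lborel borel f) borel ((+) a) = distr lborel borel (\<lambda>x. f (b + x))"
      by (simp add: distr_distr comp_def b linear_add[OF orthogonal_transformation_linear[OF f]])
    also have "\<dots> = distr (distr lborel borel ((+) b)) borel f"
      by (simp add: distr_distr comp_def)
    finally show ?thesis
      by (simp add: lborel_distr_plus)
  qed
qed simp

lemma orthogonal_transformation_vimage_sphere: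
  "orthogonal_transformation f \<Longrightarrow> f -` sphere 0 r = sphere 0 r"
  by (auto simp: orthogonal_transformation)

lemma orthogonal_transformation_image_sphere:
  fixes f :: "'a::euclidean_space \<Rightarrow> 'a"
  assumes "orthogonal_transformation f"
  shows "f ` sphere 0 r = sphere 0 r"
  by (metis assms orthogonal_transformation_surj orthogonal_transformation_vimage_sphere
      surj_image_vimage_eq)

lemma orthogonal_transformation_measurable_sphere:
  fixes f :: "real^'n \<Rightarrow> real^'n"
  assumes f: "orthogonal_transformation f"
  shows "f \<in> sphere_surface \<rightarrow>\<^sub>M sphere_surface"
proof -
  have "f \<in> restrict_space borel (sphere 0 1) \<rightarrow>\<^sub>M restrict_space borel (sphere 0 1)"
    using orthogonal_transformation_borel_measurable[OF f] f
    by (intro measurable_restrict_space3) (auto simp: orthogonal_transformation)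
  then show ?thesis
    by (simp add: measurable_cong_sets[OF sets_sphere_surface sets_sphere_surface])
qed

text \<open>The solid cone over \<open>f -` B\<close> is the preimage under \<open>f\<close> of the cone over \<open>B\<close>, so the
  invariance of volume passes to the surface measure.\<close>

lemma distr_sphere_surface_orthogonal_transformation:
  fixes f :: "real^'n \<Rightarrow> real^'n"
  assumes f: "orthogonal_transformation f"
  shows "distr sphere_surface sphere_surface f = sphere_surface"
proof (rule measure_eqI)
  fix B assume "B \<in> sets (distr sphere_surface sphere_surface f)"
  then have B_surface: "B \<in> sets (sphere_surface :: (real^'n) measure)"
    by simp
  then have B: "B \<in> sets borel" "B \<subseteq> sphere 0 1"
    by (auto simp: sets_sphere_surface sets_restrict_space)
  note [measurable] = orthogonal_transformation_borel_measurable[OF f] B(1)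
  have norm_f: "norm (f x) = norm x" for x
    using f by (simp add: orthogonal_transformation)
  have fB: "f -` B \<in> sets borel" "f -` B \<subseteq> sphere 0 1"
    using measurable_sets[OF orthogonal_transformation_borel_measurable[OF f] B(1)] B(2)
    by (auto simp: norm_f)
  have f_borel: "f \<in> lborel \<rightarrow>\<^sub>M borel"
    by simp
  have cone: "{x. 0 < norm x \<and> norm x < 1 \<and> sgn x \<in> B} \<in> sets borel"
    unfolding sgn_div_norm by measurable
  have "sgn (f x) = f (sgn x)" for x
    by (simp add: sgn_div_norm norm_f orthogonal_transformation_scaleR[OF f])
  then have vimage_cone: "f -` {x. 0 < norm x \<and> norm x < 1 \<and> sgn x \<in> B} =
      {x. 0 < norm x \<and> norm x < 1 \<and> sgn x \<in> f -` B}"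
    by (simp add: vimage_def norm_f del: zero_less_norm_iff)
  have "emeasure (distr sphere_surface sphere_surface f) B = emeasure sphere_surface (f -` B)"
    using fB(2) B_surface orthogonal_transformation_measurable_sphere[OF f]
    by (simp add: emeasure_distr space_sphere_surface Int_absorb2)
  also have "\<dots> = of_nat CARD('n) *
      emeasure (distr lborel borel f) {x. 0 < norm x \<and> norm x < 1 \<and> sgn x \<in> B}"
    unfolding emeasure_sphere_surface[OF fB] emeasure_distr[OF f_borel cone] vimage_cone by simp
  also have "\<dots> = emeasure sphere_surface B"
    by (simp add: distr_lborel_orthogonal_transformation[OF f] emeasure_sphere_surface[OF B])
  finally show "emeasure (distr sphere_surface sphere_surface f) B = emeasure sphere_surface B" .
qed simp

lemma integral_sphere_surface_orthogonal_transformation: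
  fixes f :: "real^'n \<Rightarrow> real^'n" and g :: "real^'n \<Rightarrow> 'b::{banach, second_countable_topology}"
  assumes f: "orthogonal_transformation f"
  shows "(LINT \<xi>|sphere_surface. g (f \<xi>)) = (LINT \<xi>|sphere_surface. g \<xi>)"
proof (cases "g \<in> borel_measurable sphere_surface")
  case True
  then show ?thesis
    using integral_distr[OF orthogonal_transformation_measurable_sphere[OF f] True]
    by (simp add: distr_sphere_surface_orthogonal_transformation[OF f])
next
  case False
  \<comment> \<open>Then \<open>g \<circ> f\<close> is not measurable either, and both integrals have the default value \<open>0\<close>.\<close>
  have "(\<lambda>\<xi>. g (f \<xi>)) \<notin> borel_measurable sphere_surface"
  proof
    assume "(\<lambda>\<xi>. g (f \<xi>)) \<in> borel_measurable sphere_surface"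
    from measurable_compose[OF orthogonal_transformation_measurable_sphere[OF
        orthogonal_transformation_inv[OF f]] this]
    have "g \<in> borel_measurable sphere_surface"
      by (simp add: surj_f_inv_f[OF orthogonal_transformation_surj[OF f]])
    with False show False ..
  qed
  with False show ?thesis
    by (metis borel_measurable_integrable not_integrable_integral_eq)
qed

section \<open>Existence and uniqueness of quantiles\<close>

lemma integral_quantile_loss_diff:
  assumes "prob_space M" "X \<in> borel_measurable M"
  shows "(LINT \<omega>|M. quantile_loss u p (X \<omega>) - quantile_loss u p' (X \<omega>)) =
    (LINT \<omega>|M. quantile_loss u p (X \<omega>) - quantile_loss u 0 (X \<omega>)) -
    (LINT \<omega>|M. quantile_loss u p' (X \<omega>) - quantile_loss u 0 (X \<omega>))"
proof -
  have "(LINT \<omega>|M. quantile_loss u p (X \<omega>) - quantile_loss u p' (X \<omega>)) =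
      (LINT \<omega>|M. (quantile_loss u p (X \<omega>) - quantile_loss u 0 (X \<omega>)) -
        (quantile_loss u p' (X \<omega>) - quantile_loss u 0 (X \<omega>)))"
    by (rule Bochner_Integration.integral_cong) simp_all
  then show ?thesis
    by (simp only: Bochner_Integration.integral_diff[OF integrable_quantile_loss_diff[OF assms]
          integrable_quantile_loss_diff[OF assms]])
qed

text \<open>Subtracting the loss at \<open>0\<close> turns the pairwise comparisons that define a quantile into the
  minimization of one finite function, also when \<open>X\<close> has no first moment.\<close>

lemma is_geom_quantile_iff_least:
  assumes "prob_space M" "X \<in> borel_measurable M"
  shows "is_geom_quantile M X u p \<longleftrightarrow>
    (\<forall>p'. (LINT \<omega>|M. quantile_loss u p (X \<omega>) - quantile_loss u 0 (X \<omega>))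
       \<le> (LINT \<omega>|M. quantile_loss u p' (X \<omega>) - quantile_loss u 0 (X \<omega>)))"
proof -
  have "(LINT \<omega>|M. quantile_loss u p (X \<omega>) - quantile_loss u p' (X \<omega>)) \<le> 0 \<longleftrightarrow>
      (LINT \<omega>|M. quantile_loss u p (X \<omega>) - quantile_loss u 0 (X \<omega>)) \<le>
      (LINT \<omega>|M. quantile_loss u p' (X \<omega>) - quantile_loss u 0 (X \<omega>))" for p'
    by (subst integral_quantile_loss_diff[OF assms]) (rule diff_le_0_iff_le)
  then show ?thesis
    by (simp only: is_geom_quantile_def)
qed

lemma (in prob_space) tight_norm:
  fixes X :: "'a \<Rightarrow> 'b::{real_normed_vector, second_countable_topology}"
  assumes [measurable]: "X \<in> borel_measurable M" and "0 < e"
  obtains R where "0 \<le> R" "prob {\<omega> \<in> space M. R < norm (X \<omega>)} \<le> e"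
proof -
  define E where "E n = {\<omega> \<in> space M. real n < norm (X \<omega>)}" for n
  have "(\<lambda>n. prob (E n)) \<longlonglongrightarrow> prob (\<Inter>n. E n)"
  proof (rule finite_Lim_measure_decseq)
    show "range E \<subseteq> events"
      by (auto simp: E_def)
    show "decseq E"
      unfolding E_def by (intro decseq_SucI Collect_mono) auto
  qed
  also have "(\<Inter>n. E n) = {}"
  proof -
    have "\<omega> \<notin> (\<Inter>n. E n)" for \<omega>
    proof -
      obtain n :: nat where "norm (X \<omega>) < real n"
        using reals_Archimedean2 by blast
      then have "\<omega> \<notin> E n"
        by (simp add: E_def)
      then show ?thesis
        by blast
    qed
    then show ?thesis
      by blast
  qed
  finally have "\<forall>\<^sub>F n in sequentially. prob (E n) < e"
    using \<open>0 < e\<close> by (intro order_tendstoD(2)[of _ 0]) simp_all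
  then obtain n where "prob (E n) < e"
    using eventually_happens'[OF sequentially_bot] by blast
  then show ?thesis
    using that[of "real n"] by (simp add: E_def)
qed

text \<open>Coercivity. The difference \<open>norm (x - p) - norm x\<close> is at least \<open>norm p - 2 * R\<close> if
  \<open>norm x \<le> R\<close> and at least \<open>- norm p\<close> in any case, while \<open>u \<bullet> p \<le> \<beta> * norm p\<close>. A tail
  probability of \<open>(1 - \<beta>) / 4\<close> beyond \<open>R\<close> costs at most half of the margin \<open>(1 - \<beta>) * norm p\<close>, so
  every \<open>p\<close> not worse than \<open>0\<close> has norm at most \<open>4 * R / (1 - \<beta>)\<close>. This bound is uniform in \<open>u\<close>,
  which later keeps the suprema over the sphere finite.\<close>

lemma bounded_improvers:
  fixes X :: "'a \<Rightarrow> real^'n"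
  assumes "prob_space M" and X[measurable]: "X \<in> borel_measurable M" and "\<beta> < 1"
  shows "\<exists>K. \<forall>u p. norm u \<le> \<beta> \<longrightarrow>
    (LINT \<omega>|M. quantile_loss u p (X \<omega>) - quantile_loss u 0 (X \<omega>)) \<le> 0 \<longrightarrow> norm p \<le> K"
proof -
  interpret prob_space M by fact
  obtain R where R: "0 \<le> R" "prob {\<omega> \<in> space M. R < norm (X \<omega>)} \<le> (1 - \<beta>) / 4"
    using tight_norm[OF X, of "(1 - \<beta>) / 4"] \<open>\<beta> < 1\<close> by auto
  define T where "T = {\<omega> \<in> space M. R < norm (X \<omega>)}"
  have T[measurable]: "T \<in> sets M"
    by (simp add: T_def)
  have "norm p \<le> 4 * R / (1 - \<beta>)"
    if u: "norm u \<le> \<beta>"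
      and le: "(LINT \<omega>|M. quantile_loss u p (X \<omega>) - quantile_loss u 0 (X \<omega>)) \<le> 0" for u p
  proof -
    have up: "u \<bullet> p \<le> \<beta> * norm p"
      using norm_cauchy_schwarz[of u p] mult_right_mono[OF u norm_ge_zero[of p]] by linarith
    have "(LINT \<omega>|M. norm p - 2 * R - u \<bullet> p - 2 * norm p * indicator T \<omega>)
        \<le> (LINT \<omega>|M. quantile_loss u p (X \<omega>) - quantile_loss u 0 (X \<omega>))"
    proof (rule integral_mono)
      show "integrable M (\<lambda>\<omega>. quantile_loss u p (X \<omega>) - quantile_loss u 0 (X \<omega>))"
        by (rule integrable_quantile_loss_diff) fact+
      show "integrable M (\<lambda>\<omega>. norm p - 2 * R - u \<bullet> p - 2 * norm p * indicator T \<omega>)"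
        by (intro Bochner_Integration.integrable_diff integrable_mult_right) (auto simp: less_top[symmetric])
      show "norm p - 2 * R - u \<bullet> p - 2 * norm p * indicator T \<omega>
          \<le> quantile_loss u p (X \<omega>) - quantile_loss u 0 (X \<omega>)" if "\<omega> \<in> space M" for \<omega>
        using norm_triangle_ineq2[of p "X \<omega>"] norm_triangle_ineq2[of "X \<omega>" p] R(1) that
        by (auto simp: quantile_loss_def inner_diff_right T_def norm_minus_commute indicator_def)
    qed
    also have "(LINT \<omega>|M. norm p - 2 * R - u \<bullet> p - 2 * norm p * indicator T \<omega>) =
        norm p - 2 * R - u \<bullet> p - 2 * norm p * prob T"
      by (subst Bochner_Integration.integral_diff) (auto simp: prob_space less_top[symmetric])
    finally have "norm p - 2 * R - u \<bullet> p - 2 * norm p * prob T \<le> 0"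
      using le by linarith
    moreover have "2 * norm p * prob T \<le> 2 * norm p * ((1 - \<beta>) / 4)"
      using R(2) by (intro mult_left_mono) (auto simp: T_def)
    ultimately have "(1 - \<beta>) * norm p \<le> 4 * R"
      using up by (simp add: algebra_simps)
    then show ?thesis
      using \<open>\<beta> < 1\<close> by (simp add: field_simps)
  qed
  then show ?thesis
    by blast
qed

text \<open>The normalized expected loss is Lipschitz, and its minimum over a ball containing every point
  not worse than \<open>0\<close> is a global minimum.\<close>

lemma geom_quantile_exists:
  fixes X :: "'a \<Rightarrow> real^'n"
  assumes "prob_space M" "X \<in> borel_measurable M" "norm u < 1"
  shows "\<exists>p. is_geom_quantile M X u p"
proof -
  define F where "F p = (LINT \<omega>|M. quantile_loss u p (X \<omega>) - quantile_loss u 0 (X \<omega>))" for p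
  interpret prob_space M by fact
  note int = integrable_quantile_loss_diff[OF assms(1,2)]
  obtain K where improvers: "\<forall>u' p. norm u' \<le> norm u \<longrightarrow>
      (LINT \<omega>|M. quantile_loss u' p (X \<omega>) - quantile_loss u' 0 (X \<omega>)) \<le> 0 \<longrightarrow> norm p \<le> K"
    using bounded_improvers[OF assms] ..
  have K: "norm p \<le> K" if "F p \<le> 0" for p
    using improvers[rule_format, OF order_refl] that unfolding F_def .
  have F_0: "F 0 = 0"
    by (simp add: F_def)
  have "dist (F p) (F p') \<le> (1 + norm u) * dist p p'" for p p'
  proof -
    have "F p - F p' = (LINT \<omega>|M. quantile_loss u p (X \<omega>) - quantile_loss u p' (X \<omega>))"
      unfolding F_def by (rule integral_quantile_loss_diff[OF assms(1,2), symmetric])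
    also have "\<bar>\<dots>\<bar> \<le> (LINT \<omega>|M. (1 + norm u) * norm (p - p'))"
      using int quantile_loss_diff_bounded
      by (intro order_trans[OF integral_abs_bound] integral_mono) auto
    finally show ?thesis
      by (simp add: prob_space dist_norm)
  qed
  then have "(1 + norm u)-lipschitz_on UNIV F"
    by (intro lipschitz_onI) auto
  then have "continuous_on (cball 0 K) F"
    by (rule continuous_on_subset[OF lipschitz_on_continuous_on]) simp
  moreover have "0 \<in> cball (0::real^'n) K"
    using K[of 0] by (simp add: F_0)
  ultimately obtain p where p: "p \<in> cball 0 K" "\<And>p'. p' \<in> cball 0 K \<Longrightarrow> F p \<le> F p'"
    using continuous_attains_inf[of "cball 0 K" F] by auto
  have "F p \<le> F p'" for p'
  proof (cases "F p' \<le> 0")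
    case True
    then show ?thesis
      using K[of p'] p(2)[of p'] by simp
  next
    case False
    then show ?thesis
      using p(2)[OF \<open>0 \<in> cball 0 K\<close>] by (simp add: F_0)
  qed
  then show ?thesis
    unfolding is_geom_quantile_iff_least[OF assms(1,2)] F_def by (intro exI allI)
qed

lemma rv_support_subset_closed:
  assumes "closed S" and X: "X \<in> borel_measurable M" and "AE \<omega> in M. X \<omega> \<in> S"
  shows "rv_support M X \<subseteq> S"
proof
  fix x assume x: "x \<in> rv_support M X"
  have "X -` (- S) \<inter> space M = {\<omega> \<in> space M. X \<omega> \<notin> S}"
    by auto
  moreover have "emeasure M {\<omega> \<in> space M. X \<omega> \<notin> S} = 0"
    using assms(3) by (intro emeasure_eq_0_AE) simp
  ultimately have "measure (distr M borel X) (- S) = 0"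
    using X \<open>closed S\<close> by (simp add: measure_def emeasure_distr)
  then show "x \<in> S"
    using x \<open>closed S\<close> by (auto simp: rv_support_def open_Compl)
qed

text \<open>Strict convexity: the loss at the midpoint of two quantiles cannot be smaller in the mean
  than the average of their losses, so the triangle inequality
  \<open>norm ((x - p) + (x - p')) \<le> norm (x - p) + norm (x - p')\<close> is an equality for almost all values
  \<open>x\<close>. Such \<open>x\<close> lie on the line through \<open>p\<close> and \<open>p'\<close>, which then carries the distribution.\<close>

lemma geom_quantile_unique:
  fixes X :: "'a \<Rightarrow> real^'n"
  assumes "prob_space M" and X[measurable]: "X \<in> borel_measurable M"
    and "\<not> collinear (rv_support M X)"
    and p: "is_geom_quantile M X u p" and p': "is_geom_quantile M X u p'"
  shows "p = p'"
proof (rule ccontr)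
  assume "p \<noteq> p'"
  define m where "m = midpoint p p'"
  \<comment> \<open>\<open>D\<close> is the defect in the triangle inequality, written in terms of losses. Its mean is at
    most \<open>0\<close> by minimality, since the midpoint \<open>m\<close> is not better than \<open>p\<close> or \<open>p'\<close>.\<close>
  define D where "D x = (quantile_loss u p x - quantile_loss u m x) +
    (quantile_loss u p' x - quantile_loss u m x)" for x
  note int = integrable_quantile_loss_diff[OF assms(1,2)]
  have D: "D x = norm (x - p) + norm (x - p') - norm ((x - p) + (x - p'))" for x
  proof -
    have sum: "(x - p) + (x - p') = 2 *\<^sub>R (x - m)"
      by (simp add: m_def midpoint_def scaleR_diff_right scaleR_2)
    have "u \<bullet> (x - p) + u \<bullet> (x - p') = 2 * (u \<bullet> (x - m))"
      unfolding inner_add_right[symmetric] sum by simp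
    then show ?thesis
      unfolding sum by (simp add: D_def quantile_loss_def)
  qed
  have nonneg: "0 \<le> D x" for x
    using norm_triangle_ineq[of "x - p" "x - p'"] by (simp add: D)
  have int_D: "integrable M (\<lambda>\<omega>. D (X \<omega>))"
    unfolding D_def by (intro Bochner_Integration.integrable_add int)
  have "(LINT \<omega>|M. D (X \<omega>)) \<le> 0"
    unfolding D_def using p p'
    by (subst Bochner_Integration.integral_add) (auto simp: int is_geom_quantile_def add_nonpos_nonpos)
  moreover have "0 \<le> (LINT \<omega>|M. D (X \<omega>))"
    by (intro Bochner_Integration.integral_nonneg nonneg)
  ultimately have "AE \<omega> in M. D (X \<omega>) = 0"
    using integral_nonneg_eq_0_iff_AE[OF int_D] nonneg by auto
  then have "AE \<omega> in M. X \<omega> \<in> affine hull {p, p'}"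
  proof eventually_elim
    case (elim \<omega>)
    then have "collinear {0, X \<omega> - p, X \<omega> - p'}"
      by (intro norm_triangle_eq_imp_collinear) (simp add: D)
    then have "collinear {0, p - X \<omega>, p' - X \<omega>}"
      using collinear_scaleR_iff[of "-1" "p - X \<omega>" "-1" "p' - X \<omega>"] by simp
    then have "collinear {p, X \<omega>, p'}"
      using collinear_3[of p "X \<omega>" p', unfolded NO_MATCH_def] by blast
    then show ?case
      using collinear_3_affine_hull[OF \<open>p \<noteq> p'\<close>] by (simp add: insert_commute)
  qed
  then have "rv_support M X \<subseteq> affine hull {p, p'}"
    by (intro rv_support_subset_closed) auto
  moreover have "collinear (affine hull {p, p'})"
    by (simp add: collinear_affine_hull_collinear)
  ultimately show False
    using assms(3) collinear_subset by blast
qed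

lemma ex1_geom_quantile:
  fixes X :: "'a \<Rightarrow> real^'n"
  assumes "prob_space M" "X \<in> borel_measurable M" "\<not> collinear (rv_support M X)" "norm u < 1"
  shows "\<exists>!p. is_geom_quantile M X u p"
  using geom_quantile_exists[OF assms(1,2,4)] geom_quantile_unique[OF assms(1-3)] by blast

lemma geom_quantile_bounded:
  fixes X :: "'a \<Rightarrow> real^'n"
  assumes X: "prob_space M" "X \<in> borel_measurable M" "\<not> collinear (rv_support M X)" and "\<beta> < 1"
  shows "\<exists>K. \<forall>u. norm u \<le> \<beta> \<longrightarrow> norm (geom_quantile M X u) \<le> K"
proof -
  obtain K where K: "\<forall>u p. norm u \<le> \<beta> \<longrightarrow>
      (LINT \<omega>|M. quantile_loss u p (X \<omega>) - quantile_loss u 0 (X \<omega>)) \<le> 0 \<longrightarrow> norm p \<le> K"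
    using bounded_improvers[OF X(1,2) \<open>\<beta> < 1\<close>] ..
  have "norm (geom_quantile M X u) \<le> K" if "norm u \<le> \<beta>" for u
  proof (rule K[rule_format, OF that])
    have "is_geom_quantile M X u (geom_quantile M X u)"
      unfolding geom_quantile_def
      by (rule theI'[OF ex1_geom_quantile[OF X]]) (use that \<open>\<beta> < 1\<close> in simp)
    then show "(LINT \<omega>|M. quantile_loss u (geom_quantile M X u) (X \<omega>)
        - quantile_loss u 0 (X \<omega>)) \<le> 0"
      unfolding is_geom_quantile_def ..
  qed
  then show ?thesis
    by blast
qed

section \<open>Equivariance of quantiles\<close>

text \<open>A similarity multiplies the loss by its scale factor when the index \<open>u\<close> is rotated along.\<close>

lemma quantile_loss_similarity:
  assumes f: "orthogonal_transformation f" and "0 < c"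
  shows "quantile_loss (f u) (c *\<^sub>R f p + v) (c *\<^sub>R f x + v) = c * quantile_loss u p x"
proof -
  have "c *\<^sub>R f x + v - (c *\<^sub>R f p + v) = c *\<^sub>R f (x - p)"
    by (simp add: linear_diff[OF orthogonal_transformation_linear[OF f]] scaleR_diff_right)
  then show ?thesis
    using f \<open>0 < c\<close> by (simp add: quantile_loss_def orthogonal_transformation_norm
        orthogonal_transformation_def distrib_left)
qed

lemma is_geom_quantile_similarity:
  fixes f :: "real^'n \<Rightarrow> real^'n"
  assumes f: "orthogonal_transformation f" and "0 < c"
  shows "is_geom_quantile M (\<lambda>\<omega>. c *\<^sub>R f (X \<omega>) + v) (f u) (c *\<^sub>R f p + v) \<longleftrightarrow>
    is_geom_quantile M X u p"
proof -
  have "surj (\<lambda>p. c *\<^sub>R f p + v)"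
  proof (rule surjI)
    show "c *\<^sub>R f (inv f ((y - v) /\<^sub>R c)) + v = y" for y
      using \<open>0 < c\<close> by (simp add: surj_f_inv_f[OF orthogonal_transformation_surj[OF f]])
  qed
  then have all: "(\<forall>p'. P p') \<longleftrightarrow> (\<forall>p'. P (c *\<^sub>R f p' + v))" for P :: "real^'n \<Rightarrow> bool"
  proof -
    assume surj: "surj (\<lambda>p. c *\<^sub>R f p + v)"
    have "(\<forall>p'. P p') \<longleftrightarrow> (\<forall>p'\<in>range (\<lambda>p. c *\<^sub>R f p + v). P p')"
      unfolding surj by (simp only: ball_UNIV)
    then show ?thesis
      by simp
  qed
  have "is_geom_quantile M (\<lambda>\<omega>. c *\<^sub>R f (X \<omega>) + v) (f u) (c *\<^sub>R f p + v) \<longleftrightarrow>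
      (\<forall>p'. (LINT \<omega>|M. quantile_loss (f u) (c *\<^sub>R f p + v) (c *\<^sub>R f (X \<omega>) + v)
        - quantile_loss (f u) (c *\<^sub>R f p' + v) (c *\<^sub>R f (X \<omega>) + v)) \<le> 0)"
    unfolding is_geom_quantile_def by (rule all)
  also have "\<dots> \<longleftrightarrow>
      (\<forall>p'. c * (LINT \<omega>|M. quantile_loss u p (X \<omega>) - quantile_loss u p' (X \<omega>)) \<le> 0)"
    by (simp only: quantile_loss_similarity[OF assms] right_diff_distrib[symmetric]
        integral_mult_right_zero)
  also have "\<dots> \<longleftrightarrow> is_geom_quantile M X u p"
    using \<open>0 < c\<close> by (simp add: is_geom_quantile_def mult_le_0_iff)
  finally show ?thesis .
qed

lemma geom_quantile_similarity:
  fixes f :: "real^'n \<Rightarrow> real^'n"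
  assumes f: "orthogonal_transformation f" and "0 < c" and ex1: "\<exists>!p. is_geom_quantile M X u p"
  shows "geom_quantile M (\<lambda>\<omega>. c *\<^sub>R f (X \<omega>) + v) (f u) = c *\<^sub>R f (geom_quantile M X u) + v"
proof -
  note iff = is_geom_quantile_similarity[OF f \<open>0 < c\<close>, of M X v u]
  have q: "is_geom_quantile M X u (geom_quantile M X u)"
    unfolding geom_quantile_def using ex1 by (rule theI')
  show ?thesis
    unfolding geom_quantile_def[of M "\<lambda>\<omega>. c *\<^sub>R f (X \<omega>) + v"]
  proof (rule the_equality)
    show "is_geom_quantile M (\<lambda>\<omega>. c *\<^sub>R f (X \<omega>) + v) (f u) (c *\<^sub>R f (geom_quantile M X u) + v)"
      using q iff by simp
  next
    fix r assume r: "is_geom_quantile M (\<lambda>\<omega>. c *\<^sub>R f (X \<omega>) + v) (f u) r"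
    define p where "p = inv f ((r - v) /\<^sub>R c)"
    have p: "r = c *\<^sub>R f p + v"
      using \<open>0 < c\<close> by (simp add: p_def surj_f_inv_f[OF orthogonal_transformation_surj[OF f]])
    then have "p = geom_quantile M X u"
      using r iff ex1 q by auto
    with p show "r = c *\<^sub>R f (geom_quantile M X u) + v"
      by simp
  qed
qed

lemma geom_quantile_distr:
  assumes X: "X \<in> borel_measurable M"
  shows "geom_quantile (distr M borel X) (\<lambda>x. x) u = geom_quantile M X u"
proof -
  have "(\<lambda>x. quantile_loss u p x - quantile_loss u p' x) \<in> borel_measurable borel" for p p'
    unfolding quantile_loss_def by measurable
  then have "is_geom_quantile (distr M borel X) (\<lambda>x. x) u p \<longleftrightarrow> is_geom_quantile M X u p" for p
    using X by (simp add: is_geom_quantile_def integral_distr)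
  then show ?thesis
    by (simp add: geom_quantile_def)
qed

text \<open>The centred variables \<open>X - m\<close> and \<open>f (X - m)\<close> have the same quantile at \<open>f u\<close>; by
  equivariance these are \<open>q (f u) - m\<close> and \<open>f (q u - m)\<close>.\<close>

lemma geom_quantile_symmetry:
  fixes X :: "'a \<Rightarrow> real^'n"
  assumes X[measurable]: "X \<in> borel_measurable M"
    and f: "orthogonal_transformation f"
    and sym: "distr M borel (\<lambda>\<omega>. X \<omega> - m) = distr M borel (\<lambda>\<omega>. f (X \<omega> - m))"
    and ex1: "\<exists>!p. is_geom_quantile M X u p" "\<exists>!p. is_geom_quantile M X (f u) p"
  shows "geom_quantile M X (f u) - m = f (geom_quantile M X u - m)"
proof -
  note [measurable] = orthogonal_transformation_borel_measurable[OF f]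
  have diff: "f (x - m) = 1 *\<^sub>R f x + - f m" for x
    by (simp add: linear_diff[OF orthogonal_transformation_linear[OF f]])
  have "geom_quantile M X (f u) - m = geom_quantile M (\<lambda>\<omega>. X \<omega> - m) (f u)"
    using geom_quantile_similarity[OF orthogonal_transformation_id _ ex1(2), of 1 "- m"] by simp
  also have "\<dots> = geom_quantile M (\<lambda>\<omega>. f (X \<omega> - m)) (f u)"
    using geom_quantile_distr[of "\<lambda>\<omega>. X \<omega> - m" M] geom_quantile_distr[of "\<lambda>\<omega>. f (X \<omega> - m)" M]
    by (simp add: sym)
  also have "\<dots> = f (geom_quantile M X u - m)"
    unfolding diff by (rule geom_quantile_similarity[OF f _ ex1(1)]) simp
  finally show ?thesis .
qed

section \<open>Suprema over the sphere\<close>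

lemma sphere_0_1_nonempty: "sphere (0::'a::euclidean_space) 1 \<noteq> {}"
  by (metis empty_iff mem_sphere_0 vector_choose_size zero_le_one)

text \<open>Boundedness matters: the supremum of an unbounded set of reals is an unspecified number, which
  need not scale.\<close>

lemma SUP_sphere_similarity:
  fixes f :: "'a::euclidean_space \<Rightarrow> 'a" and g h :: "'a \<Rightarrow> real"
  assumes f: "orthogonal_transformation f" and "0 < c"
    and gh: "\<And>\<xi>. norm \<xi> = 1 \<Longrightarrow> g (f \<xi>) = c * h \<xi>"
    and bdd: "bdd_above (h ` sphere 0 1)"
  shows "(SUP \<xi>\<in>sphere 0 1. g \<xi>) = c * (SUP \<xi>\<in>sphere 0 1. h \<xi>)"
proof -
  have "g ` sphere 0 1 = (\<lambda>\<xi>. g (f \<xi>)) ` sphere 0 1"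
    using orthogonal_transformation_image_sphere[OF f, of 1] by (metis image_image)
  also have "\<dots> = (*) c ` (h ` sphere 0 1)"
    by (auto simp: gh image_image intro!: image_cong)
  finally have "g ` sphere 0 1 = (*) c ` (h ` sphere 0 1)" .
  moreover have "c * Sup (h ` sphere 0 1) = (SUP s\<in>h ` sphere 0 1. c * s)"
    using \<open>0 < c\<close> bdd sphere_0_1_nonempty
    by (intro continuous_at_Sup_mono) (auto simp: mono_def mult_left_mono intro!: continuous_intros)
  ultimately show ?thesis
    by simp
qed

lemma INF_sphere_similarity:
  fixes f :: "'a::euclidean_space \<Rightarrow> 'a" and g h :: "'a \<Rightarrow> real"
  assumes f: "orthogonal_transformation f" and "0 < c"
    and gh: "\<And>\<xi>. norm \<xi> = 1 \<Longrightarrow> g (f \<xi>) = c * h \<xi>"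
    and bdd: "bdd_below (h ` sphere 0 1)"
  shows "(INF \<xi>\<in>sphere 0 1. g \<xi>) = c * (INF \<xi>\<in>sphere 0 1. h \<xi>)"
proof -
  have "bdd_above ((\<lambda>\<xi>. - h \<xi>) ` sphere 0 1)"
    using bdd by (metis bdd_above_uminus image_image)
  then have "(SUP \<xi>\<in>sphere 0 1. - g \<xi>) = c * (SUP \<xi>\<in>sphere 0 1. - h \<xi>)"
    using gh by (intro SUP_sphere_similarity[OF f \<open>0 < c\<close>]) auto
  then show ?thesis
    by (simp add: Inf_real_def image_image)
qed

section \<open>The measures of dispersion, skewness, kurtosis and asphericity\<close>

text \<open>All the measures for \<open>Z\<close> arise from quantities indexed by \<open>\<xi>\<close> on the sphere that, at the rotated
  point \<open>f \<xi>\<close>, are \<open>c\<close> times (or \<open>c *\<^sub>R f\<close> of) those for \<open>X\<close>.\<close>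

context
  fixes M :: "'a measure" and X Z :: "'a \<Rightarrow> real^'n" and f :: "real^'n \<Rightarrow> real^'n"
    and c \<beta> :: real and v :: "real^'n"
  assumes X: "prob_space M" "X \<in> borel_measurable M" "\<not> collinear (rv_support M X)"
    and f: "orthogonal_transformation f" and c: "0 < c" and \<beta>: "0 < \<beta>" "\<beta> < 1"
  defines "Z \<equiv> \<lambda>\<omega>. c *\<^sub>R f (X \<omega>) + v"
begin

private lemma quantile_rotated:
  assumes "norm \<xi> = 1"
  shows "geom_quantile M Z (\<beta> *\<^sub>R f \<xi>) = c *\<^sub>R f (geom_quantile M X (\<beta> *\<^sub>R \<xi>)) + v"
    and "geom_quantile M Z (- (\<beta> *\<^sub>R f \<xi>)) = c *\<^sub>R f (geom_quantile M X (- (\<beta> *\<^sub>R \<xi>))) + v"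
proof -
  have q: "geom_quantile M Z (f u) = c *\<^sub>R f (geom_quantile M X u) + v" if "norm u < 1" for u
    unfolding Z_def by (rule geom_quantile_similarity[OF f c ex1_geom_quantile[OF X that]])
  have f_index: "f (\<beta> *\<^sub>R \<xi>) = \<beta> *\<^sub>R f \<xi>" "f (- (\<beta> *\<^sub>R \<xi>)) = - (\<beta> *\<^sub>R f \<xi>)"
    by (simp_all add: orthogonal_transformation_scaleR[OF f]
        linear_neg[OF orthogonal_transformation_linear[OF f]])
  have "norm (\<beta> *\<^sub>R \<xi>) < 1" "norm (- (\<beta> *\<^sub>R \<xi>)) < 1"
    using assms \<beta> by simp_all
  from this[THEN q] show "geom_quantile M Z (\<beta> *\<^sub>R f \<xi>) = c *\<^sub>R f (geom_quantile M X (\<beta> *\<^sub>R \<xi>)) + v"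
    and "geom_quantile M Z (- (\<beta> *\<^sub>R f \<xi>)) = c *\<^sub>R f (geom_quantile M X (- (\<beta> *\<^sub>R \<xi>))) + v"
    by (simp_all only: f_index)
qed

private lemma median_rotated: "geom_median M Z = c *\<^sub>R f (geom_median M X) + v"
  using geom_quantile_similarity[OF f c ex1_geom_quantile[OF X], of 0 v]
  by (simp add: geom_median_def Z_def linear_0[OF orthogonal_transformation_linear[OF f]])

private lemmas f_linear = linear_add[OF orthogonal_transformation_linear[OF f]]
  linear_diff[OF orthogonal_transformation_linear[OF f]]
  orthogonal_transformation_scaleR[OF f]

private lemma norm_c_f: "norm (c *\<^sub>R f x) = c * norm x"
  using c by (simp add: orthogonal_transformation_norm[OF f])

private lemma interquantile_rotated:
  assumes "norm \<xi> = 1"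
  shows "norm (geom_quantile M Z (\<beta> *\<^sub>R f \<xi>) - geom_quantile M Z (- (\<beta> *\<^sub>R f \<xi>))) =
    c * norm (geom_quantile M X (\<beta> *\<^sub>R \<xi>) - geom_quantile M X (- (\<beta> *\<^sub>R \<xi>)))"
  unfolding norm_c_f[symmetric] quantile_rotated[OF assms]
  by (simp add: f_linear scaleR_diff_right)

private lemma skewness_rotated:
  assumes "norm \<xi> = 1"
  shows "norm (geom_quantile M Z (\<beta> *\<^sub>R f \<xi>) + geom_quantile M Z (- (\<beta> *\<^sub>R f \<xi>))
      - 2 *\<^sub>R geom_median M Z) =
    c * norm (geom_quantile M X (\<beta> *\<^sub>R \<xi>) + geom_quantile M X (- (\<beta> *\<^sub>R \<xi>))
      - 2 *\<^sub>R geom_median M X)"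
proof -
  have "2 *\<^sub>R (c *\<^sub>R f (geom_median M X) + v) = c *\<^sub>R f (2 *\<^sub>R geom_median M X) + v + v"
    by (simp add: f_linear scaleR_2[of v] scaleR_right_distrib)
  then show ?thesis
    unfolding norm_c_f[symmetric] quantile_rotated[OF assms] median_rotated
    by (simp only: f_linear(1,2) scaleR_right_distrib scaleR_diff_right) simp
qed

private lemma centred_rotated:
  assumes "norm \<xi> = 1"
  shows "geom_quantile M Z (\<beta> *\<^sub>R f \<xi>) - geom_median M Z =
    c *\<^sub>R f (geom_quantile M X (\<beta> *\<^sub>R \<xi>) - geom_median M X)"
  unfolding quantile_rotated[OF assms] median_rotated
  by (simp add: f_linear scaleR_diff_right)

private lemma quantiles_bounded:
  "\<exists>K. (\<forall>\<xi>. norm \<xi> = 1 \<longrightarrow> norm (geom_quantile M X (\<beta> *\<^sub>R \<xi>)) \<le> K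
      \<and> norm (geom_quantile M X (- (\<beta> *\<^sub>R \<xi>))) \<le> K) \<and> norm (geom_median M X) \<le> K"
proof -
  obtain K where K: "\<forall>u. norm u \<le> \<beta> \<longrightarrow> norm (geom_quantile M X u) \<le> K"
    using geom_quantile_bounded[OF X \<beta>(2)] ..
  show ?thesis
    using \<beta> by (intro exI[of _ K]) (simp add: geom_median_def K)
qed

lemma delta1_similarity: "delta1 M Z \<beta> = c * delta1 M X \<beta>"
  unfolding delta1_def
proof (rule SUP_sphere_similarity[OF f c])
  obtain K where K: "\<And>\<xi>. norm \<xi> = 1 \<Longrightarrow> norm (geom_quantile M X (\<beta> *\<^sub>R \<xi>)) \<le> K"
    "\<And>\<xi>. norm \<xi> = 1 \<Longrightarrow> norm (geom_quantile M X (- (\<beta> *\<^sub>R \<xi>))) \<le> K"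
    "norm (geom_median M X) \<le> K"
    using quantiles_bounded by blast
  show "bdd_above ((\<lambda>\<xi>. norm (geom_quantile M X (\<beta> *\<^sub>R \<xi>) - geom_quantile M X (- (\<beta> *\<^sub>R \<xi>))))
      ` sphere 0 1)"
  proof (rule bdd_aboveI2)
    show "norm (geom_quantile M X (\<beta> *\<^sub>R \<xi>) - geom_quantile M X (- (\<beta> *\<^sub>R \<xi>))) \<le> K + K"
      if "\<xi> \<in> sphere 0 1" for \<xi>
      using that by (intro order_trans[OF norm_triangle_ineq4 add_mono]) (simp_all add: K)
  qed
qed (rule interquantile_rotated)

lemma delta2_similarity: "delta2 M Z \<beta> = c * delta2 M X \<beta>"
proof -
  have "(LINT \<xi>|sphere_surface. norm (geom_quantile M Z (\<beta> *\<^sub>R \<xi>) - geom_quantile M Z (- (\<beta> *\<^sub>R \<xi>)))) =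
      (LINT \<xi>|sphere_surface.
        norm (geom_quantile M Z (\<beta> *\<^sub>R f \<xi>) - geom_quantile M Z (- (\<beta> *\<^sub>R f \<xi>))))"
    by (rule integral_sphere_surface_orthogonal_transformation[OF f, symmetric])
  also have "\<dots> = (LINT \<xi>|sphere_surface.
      c * norm (geom_quantile M X (\<beta> *\<^sub>R \<xi>) - geom_quantile M X (- (\<beta> *\<^sub>R \<xi>))))"
    by (rule Bochner_Integration.integral_cong) (simp_all add: space_sphere_surface interquantile_rotated)
  finally show ?thesis
    by (simp add: delta2_def)
qed

lemma gamma1_similarity: "gamma1 M Z \<beta> = gamma1 M X \<beta>"
proof -
  obtain K where K: "\<And>\<xi>. norm \<xi> = 1 \<Longrightarrow> norm (geom_quantile M X (\<beta> *\<^sub>R \<xi>)) \<le> K"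
    "\<And>\<xi>. norm \<xi> = 1 \<Longrightarrow> norm (geom_quantile M X (- (\<beta> *\<^sub>R \<xi>))) \<le> K"
    "norm (geom_median M X) \<le> K"
    using quantiles_bounded by blast
  have "bdd_above ((\<lambda>\<xi>. norm (geom_quantile M X (\<beta> *\<^sub>R \<xi>) + geom_quantile M X (- (\<beta> *\<^sub>R \<xi>))
      - 2 *\<^sub>R geom_median M X)) ` sphere 0 1)"
  proof (rule bdd_aboveI2)
    show "norm (geom_quantile M X (\<beta> *\<^sub>R \<xi>) + geom_quantile M X (- (\<beta> *\<^sub>R \<xi>))
        - 2 *\<^sub>R geom_median M X) \<le> (K + K) + 2 * K" if "\<xi> \<in> sphere 0 1" for \<xi>
      using that
      by (intro order_trans[OF norm_triangle_ineq4 add_mono] order_trans[OF norm_triangle_ineq add_mono])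
         (simp_all add: K)
  qed
  from SUP_sphere_similarity[OF f c skewness_rotated this] show ?thesis
    using c by (simp add: gamma1_def delta1_similarity)
qed

lemma gamma2_similarity: "gamma2 M Z \<beta> = f (gamma2 M X \<beta>)"
proof -
  let ?q = "\<lambda>\<xi>. geom_quantile M X (\<beta> *\<^sub>R \<xi>) - geom_median M X"
  have inv_f: "linear (inv f)"
    by (intro orthogonal_transformation_linear orthogonal_transformation_inv f)
  have "(LINT \<xi>|sphere_surface. geom_quantile M Z (\<beta> *\<^sub>R \<xi>) - geom_median M Z) =
      (LINT \<xi>|sphere_surface. geom_quantile M Z (\<beta> *\<^sub>R f \<xi>) - geom_median M Z)"
    by (rule integral_sphere_surface_orthogonal_transformation[OF f, symmetric])
  also have "\<dots> = (LINT \<xi>|sphere_surface. c *\<^sub>R f (?q \<xi>))"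
    by (rule Bochner_Integration.integral_cong) (simp_all add: space_sphere_surface centred_rotated)
  also have "\<dots> = c *\<^sub>R f (LINT \<xi>|sphere_surface. ?q \<xi>)"
  proof -
    \<comment> \<open>Since \<open>f\<close> has a bounded linear inverse, it commutes with the integral even if that has its
      default value \<open>0\<close>: integrability of either side implies that of the other.\<close>
    have "(LINT \<xi>|sphere_surface. f (?q \<xi>)) = f (LINT \<xi>|sphere_surface. ?q \<xi>)"
      using inv_f orthogonal_transformation_linear[OF f] orthogonal_transformation_inj[OF f]
      by (intro integral_bounded_linear'[where T' = "inv f"])
         (simp_all add: linear_conv_bounded_linear)
    then show ?thesis
      by simp
  qed
  finally show ?thesis
    using c by (simp add: gamma2_def delta2_similarity f_linear)
qed

lemma alpha_similarity: "alpha M Z \<beta> = alpha M X \<beta>"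
proof -
  let ?q = "\<lambda>\<xi>. norm (geom_quantile M X (\<beta> *\<^sub>R \<xi>) - geom_median M X)"
  obtain K where K: "\<And>\<xi>. norm \<xi> = 1 \<Longrightarrow> norm (geom_quantile M X (\<beta> *\<^sub>R \<xi>)) \<le> K"
    "\<And>\<xi>. norm \<xi> = 1 \<Longrightarrow> norm (geom_quantile M X (- (\<beta> *\<^sub>R \<xi>))) \<le> K"
    "norm (geom_median M X) \<le> K"
    using quantiles_bounded by blast
  have rotated: "norm (geom_quantile M Z (\<beta> *\<^sub>R f \<xi>) - geom_median M Z) = c * ?q \<xi>" if "norm \<xi> = 1" for \<xi>
    unfolding centred_rotated[OF that] by (rule norm_c_f)
  have "bdd_above (?q ` sphere 0 1)"
  proof (rule bdd_aboveI2)
    show "?q \<xi> \<le> K + K" if "\<xi> \<in> sphere 0 1" for \<xi>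
      using that by (intro order_trans[OF norm_triangle_ineq4 add_mono]) (simp_all add: K)
  qed
  from SUP_sphere_similarity[OF f c rotated this]
  have sup: "(SUP \<xi>\<in>sphere 0 1. norm (geom_quantile M Z (\<beta> *\<^sub>R \<xi>) - geom_median M Z)) =
    c * (SUP \<xi>\<in>sphere 0 1. ?q \<xi>)" by simp
  have "bdd_below (?q ` sphere 0 1)"
    by (rule bdd_belowI2[where m = 0]) simp
  from INF_sphere_similarity[OF f c rotated this]
  have "(INF \<xi>\<in>sphere 0 1. norm (geom_quantile M Z (\<beta> *\<^sub>R \<xi>) - geom_median M Z)) =
    c * (INF \<xi>\<in>sphere 0 1. ?q \<xi>)" by simp
  with sup show ?thesis
    using c by (simp add: alpha_def)
qed

end

text \<open>The centred quantile map is odd, so its symmetric part, whose norm \<open>gamma1\<close> measures, and its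
  mean over the sphere vanish.\<close>

lemma gammas_zero_of_non_skewed:
  fixes X :: "'a \<Rightarrow> real^'n"
  assumes X: "prob_space M" "X \<in> borel_measurable M" "\<not> collinear (rv_support M X)"
    and "0 < \<beta>" "\<beta> < 1" and sym: "non_skewed M X"
  shows "gamma1 M X \<beta> = 0" and "gamma2 M X \<beta> = 0"
proof -
  define g where "g \<xi> = geom_quantile M X (\<beta> *\<^sub>R \<xi>) - geom_median M X" for \<xi>
  have uminus: "orthogonal_transformation (uminus :: real^'n \<Rightarrow> real^'n)"
    using orthogonal_transformation_neg[of "\<lambda>x::real^'n. x"] by simp
  have odd: "geom_quantile M X (- (\<beta> *\<^sub>R \<xi>)) - geom_median M X = - g \<xi>" if "norm \<xi> = 1" for \<xi>
    unfolding g_def using sym that \<open>0 < \<beta>\<close> \<open>\<beta> < 1\<close>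
    by (intro geom_quantile_symmetry[OF X(2) uminus] ex1_geom_quantile[OF X])
       (simp_all add: non_skewed_def)
  have "geom_quantile M X (\<beta> *\<^sub>R \<xi>) + geom_quantile M X (- (\<beta> *\<^sub>R \<xi>)) - 2 *\<^sub>R geom_median M X = 0"
    if "norm \<xi> = 1" for \<xi>
    using odd[OF that] by (simp add: g_def scaleR_2 algebra_simps)
  then have "(SUP \<xi>\<in>sphere 0 1. norm (geom_quantile M X (\<beta> *\<^sub>R \<xi>) + geom_quantile M X (- (\<beta> *\<^sub>R \<xi>))
      - 2 *\<^sub>R geom_median M X)) = (SUP \<xi>\<in>sphere (0::real^'n) 1. 0)"
    by (intro SUP_cong) auto
  then show "gamma1 M X \<beta> = 0"
    by (simp add: gamma1_def sphere_0_1_nonempty)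
  have "(LINT \<xi>|sphere_surface. g \<xi>) = (LINT \<xi>|sphere_surface. g (- \<xi>))"
    by (rule integral_sphere_surface_orthogonal_transformation[OF uminus, symmetric])
  also have "\<dots> = (LINT \<xi>|sphere_surface. - g \<xi>)"
    using odd by (intro Bochner_Integration.integral_cong)
      (simp_all add: space_sphere_surface g_def[of "- _"])
  finally have "(LINT \<xi>|sphere_surface. g \<xi>) = 0"
    by (simp add: eq_neg_iff_add_eq_0 scaleR_2[symmetric])
  then show "gamma2 M X \<beta> = 0"
    by (simp add: gamma2_def g_def)
qed

text \<open>Rotations act transitively on the sphere, so the distance from the quantiles of level \<open>\<beta>\<close>
  to the median is constant and the quotient in \<open>alpha\<close> is \<open>1\<close>.\<close>

lemma alpha_zero_of_spherically_symmetric: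
  fixes X :: "'a \<Rightarrow> real^'n"
  assumes X: "prob_space M" "X \<in> borel_measurable M" "\<not> collinear (rv_support M X)"
    and "0 < \<beta>" "\<beta> < 1" and sym: "spherically_symmetric M X"
    and neq: "\<forall>\<xi>\<in>sphere 0 1. geom_quantile M X (\<beta> *\<^sub>R \<xi>) \<noteq> geom_median M X"
  shows "alpha M X \<beta> = 0"
proof -
  let ?q = "\<lambda>\<xi>. norm (geom_quantile M X (\<beta> *\<^sub>R \<xi>) - geom_median M X)"
  obtain \<eta> :: "real^'n" where \<eta>: "norm \<eta> = 1"
    using vector_choose_size[of 1] by auto
  have const: "?q \<xi> = ?q \<eta>" if "norm \<xi> = 1" for \<xi>
  proof -
    have "norm \<eta> = norm \<xi>"
      using that \<eta> by simp
    then obtain f where f: "orthogonal_transformation f" "f \<eta> = \<xi>"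
      by (rule orthogonal_transformation_exists)
    then have matrix: "orthogonal_matrix (matrix f)" "f = (*v) (matrix f)"
      by (auto simp: orthogonal_transformation_matrix matrix_vector_mul)
    have "geom_quantile M X (f (\<beta> *\<^sub>R \<eta>)) - geom_median M X =
        f (geom_quantile M X (\<beta> *\<^sub>R \<eta>) - geom_median M X)"
    proof (intro geom_quantile_symmetry[OF X(2) f(1)] ex1_geom_quantile[OF X])
      show "distr M borel (\<lambda>\<omega>. X \<omega> - geom_median M X) =
          distr M borel (\<lambda>\<omega>. f (X \<omega> - geom_median M X))"
        using sym matrix unfolding spherically_symmetric_def by metis
    qed (use \<eta> \<open>0 < \<beta>\<close> \<open>\<beta> < 1\<close> in \<open>simp_all add: orthogonal_transformation_norm[OF f(1)]\<close>)
    then show ?thesis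
      by (simp add: f(2) orthogonal_transformation_scaleR[OF f(1)] orthogonal_transformation_norm[OF f(1)])
  qed
  have "(SUP \<xi>\<in>sphere 0 1. ?q \<xi>) = (SUP \<xi>\<in>sphere (0::real^'n) 1. ?q \<eta>)"
    using const by (intro SUP_cong) auto
  moreover have "(INF \<xi>\<in>sphere 0 1. ?q \<xi>) = (INF \<xi>\<in>sphere (0::real^'n) 1. ?q \<eta>)"
    using const by (intro INF_cong) auto
  moreover have "?q \<eta> \<noteq> 0"
    using neq \<eta> by auto
  ultimately show ?thesis
    by (simp add: alpha_def sphere_0_1_nonempty)
qed

theorem proposition2p1:
  fixes M :: "'a measure" and Y :: "'a \<Rightarrow> real^'n" and \<beta> :: real
  assumes "CARD('n) \<ge> 2"
    and "0 < \<beta>" and "\<beta> < 1"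
    and "prob_space M" and "Y \<in> borel_measurable M"
    and "\<not> collinear (rv_support M Y)"
  shows
    "(non_skewed M Y \<and>
        (\<exists>\<xi>\<in>sphere 0 1. geom_quantile M Y (\<beta> *\<^sub>R \<xi>) \<noteq> geom_quantile M Y (- (\<beta> *\<^sub>R \<xi>)))
        \<longrightarrow> gamma1 M Y \<beta> = 0 \<and> gamma2 M Y \<beta> = 0)
     \<and>
     (spherically_symmetric M Y \<and>
        (\<forall>\<xi>\<in>sphere 0 1. geom_quantile M Y (\<beta> *\<^sub>R \<xi>) \<noteq> geom_median M Y)
        \<longrightarrow> alpha M Y \<beta> = 0)
     \<and>
     (\<forall>(A :: real^'n^'n) (c :: real) (v :: real^'n) (\<beta>' :: real).
        orthogonal_matrix A \<and> 0 < c \<and> \<beta> < \<beta>' \<and> \<beta>' < 1 \<longrightarrow>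
        (let Z = (\<lambda>\<omega>. c *\<^sub>R (A *v Y \<omega>) + v) in
          delta1 M Z \<beta> = c * delta1 M Y \<beta> \<and>
          delta2 M Z \<beta> = c * delta2 M Y \<beta> \<and>
          ((\<exists>\<xi>\<in>sphere 0 1. geom_quantile M Y (\<beta> *\<^sub>R \<xi>) \<noteq> geom_quantile M Y (- (\<beta> *\<^sub>R \<xi>)))
            \<longrightarrow> gamma1 M Z \<beta> = gamma1 M Y \<beta> \<and>
                gamma2 M Z \<beta> = A *v gamma2 M Y \<beta> \<and>
                kappa1 M Z \<beta> \<beta>' = kappa1 M Y \<beta> \<beta>' \<and>
                kappa2 M Z \<beta> \<beta>' = kappa2 M Y \<beta> \<beta>') \<and>
          ((\<forall>\<xi>\<in>sphere 0 1. geom_quantile M Y (\<beta> *\<^sub>R \<xi>) \<noteq> geom_median M Y)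
            \<longrightarrow> alpha M Z \<beta> = alpha M Y \<beta>)))"
proof (intro conjI impI allI, goal_cases)
  case 1
  then show ?case
    using gammas_zero_of_non_skewed[OF assms(4-6,2,3)] by blast
next
  case 2
  then show ?case
    using gammas_zero_of_non_skewed[OF assms(4-6,2,3)] by blast
next
  case 3
  then show ?case
    using alpha_zero_of_spherically_symmetric[OF assms(4-6,2,3)] by blast
next
  case (4 A c v \<beta>')
  then have "0 < c" "0 < \<beta>'" "\<beta>' < 1"
    using \<open>0 < \<beta>\<close> by auto
  have f: "orthogonal_transformation ((*v) A)"
    using 4 by (simp add: orthogonal_transformation_matrix)
  note similarity = assms(4-6) f \<open>0 < c\<close>
  show ?case
    using \<open>0 < c\<close> delta1_similarity[OF similarity assms(2,3)] delta2_similarity[OF similarity assms(2,3)]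
      delta1_similarity[OF similarity \<open>0 < \<beta>'\<close> \<open>\<beta>' < 1\<close>] delta2_similarity[OF similarity \<open>0 < \<beta>'\<close> \<open>\<beta>' < 1\<close>]
      gamma1_similarity[OF similarity assms(2,3)] gamma2_similarity[OF similarity assms(2,3)]
      alpha_similarity[OF similarity assms(2,3)]
    by (simp add: Let_def kappa1_def kappa2_def)
qed

end
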